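(* For any $n \geq 2$, $sat(K_3^n,C_4) = 3n$. Moreover, writing the parts of $K_3^n$ as $V_1,V_2,V_3$, a spanning subgraph $H$ of $K_3^n$ is $C_4$-saturated relative to $K_3^n$ with exactly $3n$ edges if and only if $H$ has the following form: there are vertices $x_1\in V_1$, $x_2\in V_2$, $x_3\in V_3$ forming a triangle, and there is a bijection $\sigma:[3]\to[3]$ with $\sigma(i)\neq i$ for all $i$ such that every vertex of $V_i\setminus\{x_i\}$ has degree $1$ in $H$ with unique neighbour $x_{\sigma(i)}$, for each $i\in[3]$ (i.e. $H\in\Omega^{(4,3,n)}$).
   Context: All graphs are finite, simple and undirected. $K_k^n$ denotes the complete $k$-partite graph with exactly $n$ vertices in each of its $k$ parts. $C_4$ is the cycle on $4$ vertices. For graphs $G$ and $F$, a spanning subgraph $H$ of $G$ is $F$-saturated relative to $G$ if $H$ contains no copy of $F$ but $H+e$ contains a copy of $F$ for every $e\in E(G)\setminus E(H)$; $sat(G,F)$ is the minimum number of edges of a graph that is $F$-saturated relative to $G$. $\Omega^{(4,3,n)}$ denotes the family of graphs described in the claim (all of which are isomorphic). *)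

theory Defs
  imports Main
begin

(* A graph is a pair of a vertex set and a set of edges, an edge being the
   two-element set of its end vertices. *)
type_synonym 'a graph = "'a set \<times> 'a set set"

abbreviation verts :: "'a graph \<Rightarrow> 'a set" where
  "verts \<equiv> fst"

abbreviation edges :: "'a graph \<Rightarrow> 'a set set" where
  "edges \<equiv> snd"

definition fin_simple_graph :: "'a graph \<Rightarrow> bool" where
  "fin_simple_graph G \<longleftrightarrow>
     finite (verts G) \<and> (\<forall>e\<in>edges G. e \<subseteq> verts G \<and> card e = 2)"

definition spanning_subgraph :: "'a graph \<Rightarrow> 'a graph \<Rightarrow> bool" where
  "spanning_subgraph H G \<longleftrightarrow>
     fin_simple_graph H \<and> verts H = verts G \<and> edges H \<subseteq> edges G"

definition neighbours :: "'a graph \<Rightarrow> 'a \<Rightarrow> 'a set" where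
  "neighbours G v = {u. {u, v} \<in> edges G}"

definition degree :: "'a graph \<Rightarrow> 'a \<Rightarrow> nat" where
  "degree G v = card (neighbours G v)"

definition add_edge :: "'a graph \<Rightarrow> 'a set \<Rightarrow> 'a graph" where
  "add_edge G e = (verts G, insert e (edges G))"

(* G contains a copy of F: a subgraph, not necessarily induced, isomorphic to F. *)
definition contains_copy :: "'a graph \<Rightarrow> 'b graph \<Rightarrow> bool" where
  "contains_copy G F \<longleftrightarrow>
     (\<exists>f. inj_on f (verts F) \<and> f ` verts F \<subseteq> verts G \<and> (\<forall>e\<in>edges F. f ` e \<in> edges G))"

definition saturated :: "'a graph \<Rightarrow> 'a graph \<Rightarrow> 'b graph \<Rightarrow> bool" where
  "saturated H G F \<longleftrightarrow>
     spanning_subgraph H G \<and> \<not> contains_copy H F \<and>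
     (\<forall>e \<in> edges G - edges H. contains_copy (add_edge H e) F)"

definition sat :: "'a graph \<Rightarrow> 'b graph \<Rightarrow> nat" where
  "sat G F = (LEAST m. \<exists>H. saturated H G F \<and> card (edges H) = m)"

definition part :: "nat \<Rightarrow> nat \<Rightarrow> (nat \<times> nat) set" where
  "part n i = {i} \<times> {1..n}"

definition complete_multipartite :: "nat \<Rightarrow> nat \<Rightarrow> (nat \<times> nat) graph" where
  "complete_multipartite k n =
     (\<Union>i\<in>{1..k}. part n i,
      {{u, v} | u v i j. i \<in> {1..k} \<and> j \<in> {1..k} \<and> i \<noteq> j \<and> u \<in> part n i \<and> v \<in> part n j})"

(* This is the cycle on k vertices only for k at least 3. *)
definition cycle_graph :: "nat \<Rightarrow> nat graph" where
  "cycle_graph k = ({..<k}, {{i, (i + 1) mod k} | i. i < k})"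

definition Omega_4_3 :: "nat \<Rightarrow> (nat \<times> nat) graph set" where
  "Omega_4_3 n =
     {H. spanning_subgraph H (complete_multipartite 3 n) \<and>
         (\<exists>x \<sigma>. (\<forall>i\<in>{1..3}. x i \<in> part n i) \<and>
            {x 1, x 2} \<in> edges H \<and> {x 2, x 3} \<in> edges H \<and> {x 1, x 3} \<in> edges H \<and>
            bij_betw \<sigma> {1..3} {1..3} \<and> (\<forall>i\<in>{1..3}. \<sigma> i \<noteq> i) \<and>
            (\<forall>i\<in>{1..3}. \<forall>v \<in> part n i - {x i}.
               degree H v = 1 \<and> neighbours H v = {x (\<sigma> i)}))}"

end

theory Submission
  imports Defs
begin

text \<open>
  If all neighbours of each vertex had the same colour, then a vertex would reach only one of the two
  other colours by paths of length 1 or 3. So some vertex has two neighbours of different colours;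
  these are adjacent or joined by a path of length 3, which gives a triangle or a pentagon \<open>C\<close>.
  The graph is connected, so every vertex has an edge to its successor \<open>f v\<close>, which is the next vertex
  on \<open>C\<close> if \<open>v \<in> C\<close> and closer to \<open>C\<close> otherwise. These edges are pairwise distinct, so there are at
  least \<open>3 * n\<close> edges, and in the case of equality there are no others. A path of length 3 from \<open>u\<close> to
  \<open>w\<close> then ascends and afterwards descends, that is, \<open>(f ^^ i) u = (f ^^ j) w\<close> with \<open>i + j = 3\<close>. If \<open>C\<close>
  is a pentagon, this forces every vertex outside \<open>C\<close> to be pendant at \<open>C\<close> and coloured as both
  neighbours on \<open>C\<close> of its successor; as each colour class has at least two vertices, each
  colour would occur twice on \<open>C\<close>. If \<open>C\<close> is a triangle, a vertex not
  pendant at \<open>C\<close> would leave a colour class with a single vertex, so all other vertices are pendant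
  at \<open>C\<close>, those at the same vertex being of the same colour.
\<close>

section \<open>Functional graphs and distances\<close>

text \<open>The first two disjuncts are adjacency by edges \<open>{v, f v}\<close>; the other four
  are \<open>(f ^^ i) u = (f ^^ j) w\<close> with \<open>i + j = 3\<close>.\<close>

definition linked :: "('a \<Rightarrow> 'a) \<Rightarrow> 'a \<Rightarrow> 'a \<Rightarrow> bool" where
  "linked f u w \<longleftrightarrow> f u = w \<or> f w = u \<or> f (f (f u)) = w \<or> f (f u) = f w \<or>
     f u = f (f w) \<or> f (f (f w)) = u"

text \<open>A descent cannot be followed by an ascent: both edges would lead to the unique successor
  of the vertex between them, against \<open>b \<noteq> u\<close> or
  \<open>a \<noteq> w\<close>.\<close>

lemma linked_if_path:
  assumes "f u = a \<or> f a = u" "f a = b \<or> f b = a" "f b = w \<or> f w = b" "a \<noteq> w" "b \<noteq> u"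
  shows "linked f u w"
  using assms unfolding linked_def by auto

text \<open>\<open>{v, f v} = {u, f u}\<close> with \<open>u \<noteq> v\<close> would give
  \<open>f (f v) = v\<close>, so sending \<open>v\<close> to \<open>{v, f v}\<close> is injective on
  \<open>V\<close>.\<close>

lemma functional_edges:
  assumes fin: "finite E" and E: "\<And>v. v \<in> V \<Longrightarrow> {v, f v} \<in> E"
    and ff: "\<And>v. v \<in> V \<Longrightarrow> f (f v) \<noteq> v"
  shows "card V \<le> card E"
    and "card E = card V \<Longrightarrow> E = (\<lambda>v. {v, f v}) ` V"
proof -
  have inj: "inj_on (\<lambda>v. {v, f v}) V"
    using ff by (force simp: inj_on_def doubleton_eq_iff)
  have sub: "(\<lambda>v. {v, f v}) ` V \<subseteq> E" using E by auto
  show "card V \<le> card E"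
    using card_inj_on_le[OF inj sub fin] .
  show "E = (\<lambda>v. {v, f v}) ` V" if "card E = card V"
    using card_subset_eq[OF fin sub] that card_image[OF inj] by simp
qed

text \<open>Take for \<open>d\<close> the distance to \<open>C\<close> along \<open>A\<close> and
  for \<open>f v\<close> the second vertex of a shortest walk from \<open>v\<close> to
  \<open>C\<close>.\<close>

lemma obtain_parent_function:
  assumes "\<And>v. v \<in> V \<Longrightarrow> \<exists>c\<in>C. A\<^sup>*\<^sup>* v c"
  obtains d :: "'a \<Rightarrow> nat" and f where "\<And>v. v \<in> V - C \<Longrightarrow> A v (f v) \<and> d (f v) < d v"
proof -
  define d where "d = (\<lambda>v. LEAST k. \<exists>c\<in>C. (A ^^ k) v c)"
  have "\<exists>u. A v u \<and> d u < d v" if v: "v \<in> V - C" for v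
  proof -
    have "\<exists>k. \<exists>c\<in>C. (A ^^ k) v c"
      using assms[of v] v by (meson DiffD1 rtranclp_imp_relpowp)
    then have "\<exists>c\<in>C. (A ^^ d v) v c"
      unfolding d_def by (rule LeastI_ex)
    then obtain c where c: "c \<in> C" "(A ^^ d v) v c" by blast
    with v obtain k where k: "d v = Suc k" by (cases "d v") auto
    then obtain u where u: "A v u" "(A ^^ k) u c"
      using c relpowp_Suc_D2 by metis
    have "d u \<le> k"
      unfolding d_def by (rule Least_le) (use u c in blast)
    with u k show ?thesis by auto
  qed
  then obtain f where "\<And>v. v \<in> V - C \<Longrightarrow> A v (f v) \<and> d (f v) < d v" by metis
  then show thesis by (rule that)
qed

section \<open>Functional graphs around a pentagon or a triangle\<close>

text \<open>This models the case of equality, with edges \<open>{v, f v}\<close>, cycle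
  \<open>C\<close> and colouring \<open>p\<close>. As \<open>c\<close> is arbitrary in
  \<open>two\<close>, each colour class has at least two vertices; \<open>d\<close> is the induction
  measure outside \<open>C\<close>.\<close>

locale coloured_functional_graph =
  fixes V C :: "'a set" and f :: "'a \<Rightarrow> 'a" and p :: "'a \<Rightarrow> nat" and d :: "'a \<Rightarrow> nat"
  assumes f_in: "v \<in> V \<Longrightarrow> f v \<in> V"
    and proper: "v \<in> V \<Longrightarrow> p (f v) \<noteq> p v"
    and colours: "p ` V \<subseteq> {1..3}"
    and two: "i \<in> {1..3} \<Longrightarrow> \<exists>v\<in>V. p v = i \<and> v \<noteq> c"
    and linked: "u \<in> V \<Longrightarrow> w \<in> V \<Longrightarrow> p u \<noteq> p w \<Longrightarrow> linked f u w"
    and C_sub: "C \<subseteq> V"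
    and f_C: "c \<in> C \<Longrightarrow> f c \<in> C"
    and descent: "v \<in> V - C \<Longrightarrow> d (f v) < d v"
begin

lemma funpow_in: "v \<in> V \<Longrightarrow> (f ^^ k) v \<in> V"
  by (induction k) (auto simp: f_in)

lemma funpow_C: "c \<in> C \<Longrightarrow> (f ^^ k) c \<in> C"
  by (induction k) (auto simp: f_C)

text \<open>Moving along \<open>f\<close> leads from a vertex more than \<open>k\<close> steps from
  \<open>C\<close> to one exactly \<open>k + 1\<close> steps away. So a vertex too far from
  \<open>C\<close> may be assumed to be at the least forbidden distance.\<close>

lemma exists_last_outside:
  assumes "v \<in> V" "(f ^^ k) v \<notin> C"
  shows "\<exists>w\<in>V. (f ^^ k) w \<in> V - C \<and> f ((f ^^ k) w) \<in> C"
  using assms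
proof (induction "d v" arbitrary: v rule: less_induct)
  case less
  show ?case
  proof (cases "f ((f ^^ k) v) \<in> C")
    case True
    then show ?thesis using less.prems funpow_in by blast
  next
    case False
    have "v \<in> V - C" using less.prems funpow_C by blast
    then show ?thesis
      using less.hyps[of "f v"] descent[of v] f_in[of v] False by (simp add: funpow_swap1)
  qed
qed

lemma pentagon_impossible:
  assumes C: "C = {c0, c1, c2, c3, c4}" and dist: "distinct [c0, c1, c2, c3, c4]"
    and f: "f c0 = c1" "f c1 = c2" "f c2 = c3" "f c3 = c4" "f c4 = c0"
  shows False
proof -
  have deep: "f v \<in> C" if v: "v \<in> V - C" for v
  proof (rule ccontr)
    assume "f v \<notin> C"
    then obtain w where w: "w \<in> V - C" "f w \<in> V - C" "f (f w) \<in> C"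
      using v exists_last_outside[of v 1] f_C by auto
    \<comment> \<open>For \<open>x = f (f w)\<close> these are the two vertices of the pentagon not
      adjacent to \<open>x\<close>. They are adjacent to each other, so they cannot both have the
      colour of \<open>w\<close>.\<close>
    have "\<not> linked f w (f (f (f (f w)))) \<and> \<not> linked f w (f (f (f (f (f w)))))"
      using w dist f unfolding C linked_def by auto
    then have "p w = p (f (f (f (f w))))" "p w = p (f (f (f (f (f w)))))"
      using linked[of w "f (f (f (f w)))"] linked[of w "f (f (f (f (f w))))"] w f_in by auto
    then show False
      using proper[of "f (f (f (f w)))"] f_in w by auto
  qed
  have col: "p v = p (f (f v)) \<and> p v = p (f (f (f (f (f v)))))" if v: "v \<in> V - C" for v
  proof -
    \<comment> \<open>These are the successor and the predecessor of \<open>f v\<close> on the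
      pentagon.\<close>
    have "\<not> linked f v (f (f v)) \<and> \<not> linked f v (f (f (f (f (f v)))))"
      using v deep[OF v] dist f unfolding C linked_def by auto
    then show ?thesis
      using linked[of v "f (f v)"] linked[of v "f (f (f (f (f v))))"] v f_in by auto
  qed
  \<comment> \<open>A vertex of colour \<open>i\<close> outside \<open>C\<close> gives its colour to
    both neighbours of its successor on \<open>C\<close>; if there is none, the whole class lies on
    \<open>C\<close>. Three such pairs do not fit into five vertices.\<close>
  have double: "\<exists>c\<in>C. \<exists>c'\<in>C. c \<noteq> c' \<and> p c = i \<and> p c' = i" if i: "i \<in> {1..3}" for i
  proof (cases "\<exists>v\<in>V - C. p v = i")
    case True
    then obtain v where v: "v \<in> V - C" "p v = i" by blast
    have "f (f v) \<in> C" "f (f (f (f (f v)))) \<in> C" using deep[OF v(1)] f_C by auto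
    moreover have "f (f v) \<noteq> f (f (f (f (f v))))"
      using deep[OF v(1)] dist f unfolding C by auto
    ultimately show ?thesis using col[OF v(1)] v by metis
  next
    case False
    obtain u where "u \<in> V" "p u = i" using two[OF i] by blast
    moreover obtain w where "w \<in> V" "p w = i" "w \<noteq> u" using two[OF i] by blast
    ultimately show ?thesis using False by blast
  qed
  obtain a1 b1 where 1: "{a1, b1} \<subseteq> C" "a1 \<noteq> b1" "p a1 = 1" "p b1 = 1" using double[of 1] by auto
  obtain a2 b2 where 2: "{a2, b2} \<subseteq> C" "a2 \<noteq> b2" "p a2 = 2" "p b2 = 2" using double[of 2] by auto
  obtain a3 b3 where 3: "{a3, b3} \<subseteq> C" "a3 \<noteq> b3" "p a3 = 3" "p b3 = 3" using double[of 3] by auto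
  have "distinct [a1, b1, a2, b2, a3, b3]" using 1 2 3 by auto
  then have "card (set [a1, b1, a2, b2, a3, b3]) = 6" by (subst distinct_card) auto
  moreover have "set [a1, b1, a2, b2, a3, b3] \<subseteq> C" using 1 2 3 by simp
  moreover have "card C = 5" using dist unfolding C by simp
  moreover have "finite C" unfolding C by simp
  ultimately show False using card_mono[of C "set [a1, b1, a2, b2, a3, b3]"] by simp
qed

text \<open>A vertex at distance 2 from \<open>C\<close> would force all vertices of some colour
  into \<open>C\<close>, where each colour occurs only once.\<close>

lemma triangle_pendants:
  assumes C: "C = {c0, c1, c2}"
    and f: "f c0 = c1" "f c1 = c2" "f c2 = c0"
  shows "\<And>v. v \<in> V - C \<Longrightarrow> f v \<in> C"
    and "\<And>u v. u \<in> V - C \<Longrightarrow> v \<in> V - C \<Longrightarrow> f u = f v \<Longrightarrow> p u = p v"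
proof -
  have pC: "p (f c) \<noteq> p c" "p (f (f c)) \<noteq> p c" "p (f (f c)) \<noteq> p (f c)" "f (f (f c)) = c"
    if "c \<in> C" for c
    using that f C_sub proper[of c0] proper[of c1] proper[of c2] unfolding C by auto
  have C_eq: "C = {c, f c, f (f c)}" if "c \<in> C" for c
    using that f unfolding C by auto
  \<comment> \<open>\<open>u\<close> and \<open>v\<close> enter the triangle at the same vertex, so
    one and two steps lead to different vertices; zero and three steps compare a vertex outside
    \<open>C\<close> with one on it.\<close>
  have sib: "p u = p v" if "u \<in> V - C" "v \<in> V - C" "f u = f v" "f v \<in> C" for u v
  proof -
    have "\<not> linked f u v"
      using that pC[OF that(4)] f_C[of "f v"] f_C[of "f (f v)"] unfolding linked_def by auto
    then show ?thesis using linked that by blast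
  qed
  have depth: "f v \<in> C" if v: "v \<in> V - C" for v
  proof (rule ccontr)
    assume "f v \<notin> C"
    then obtain w where w: "w \<in> V - C" "f w \<in> V - C" "f (f w) \<in> C"
      using v exists_last_outside[of v 1] f_C by auto
    define x where "x = f (f w)"
    have x: "x \<in> C" "f x \<in> C" "f (f x) \<in> C" using w f_C by (auto simp: x_def)
    note px = pC[OF x(1)]
    have xw: "p w = p x"
    proof (rule ccontr)
      assume "p w \<noteq> p x"
      then have "linked f w x" using linked w x C_sub by blast
      then show False using w x px unfolding linked_def x_def[symmetric] by auto
    qed
    \<comment> \<open>A vertex \<open>s\<close> three steps from \<open>C\<close>, entering at
      \<open>y\<close>, would be linked neither to \<open>f y\<close> nor to \<open>f (f y)\<close>,
      which have different colours.\<close>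
    have shallow: "f (f t) \<in> C" if t: "t \<in> V" for t
    proof (rule ccontr)
      assume "f (f t) \<notin> C"
      then obtain s where s: "s \<in> V" "f (f s) \<in> V - C" "f (f (f s)) \<in> C"
        using t exists_last_outside[of t 2] by (auto simp: numeral_2_eq_2)
      define y where "y = f (f (f s))"
      have y: "y \<in> C" "f y \<in> C" "f (f y) \<in> C" using s f_C by (auto simp: y_def)
      have sC: "s \<notin> C" "f s \<notin> C" using s f_C by auto
      note py = pC[OF y(1)]
      have "\<not> linked f s (f y)" "\<not> linked f s (f (f y))"
        using s sC y py unfolding linked_def y_def[symmetric] by auto
      then have "p s = p (f y)" "p s = p (f (f y))" using linked s y C_sub by blast+
      then show False using py by simp
    qed
    \<comment> \<open>\<open>w\<close> has the colour of \<open>x\<close>, so it is linked to each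
      \<open>t\<close> of the third colour; by \<open>shallow\<close>, no iterate of
      \<open>t\<close> reaches \<open>w\<close> or \<open>f w\<close>.\<close>
    have others: "t = f x \<or> f t = x" if t: "t \<in> V" "p t \<noteq> p x" "p t \<noteq> p (f w)" for t
    proof -
      have "linked f w t" using linked[of w t] t w xw by simp
      moreover have "f t \<noteq> w" "f (f t) \<noteq> f w" "f (f (f t)) \<noteq> w"
        using shallow[of t] shallow[OF f_in, of t] t w f_C
          f_in[of t] by (metis DiffD2)+
      ultimately show ?thesis using t unfolding linked_def x_def by auto
    qed
    \<comment> \<open>Outside \<open>C\<close>, \<open>t\<close> would hang at \<open>x\<close>
      beside \<open>f w\<close> and so have the colour of \<open>f w\<close>.\<close>
    have in_C: "t \<in> C" if t: "t \<in> V" "p t \<noteq> p x" "p t \<noteq> p (f w)" for t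
    proof (rule ccontr)
      assume "t \<notin> C"
      then have "f t = x" using others[OF t] x by auto
      then show False using sib[of t "f w"] t w \<open>t \<notin> C\<close> by (auto simp: x_def)
    qed
    have "{1..3::nat} = {1, 2, 3}" by auto
    then have "\<exists>i\<in>{1..3}. i \<noteq> p x \<and> i \<noteq> p (f w)" by auto
    then obtain i where i: "i \<in> {1..3}" "i \<noteq> p x" "i \<noteq> p (f w)" by blast
    obtain s where s: "s \<in> V" "p s = i" using two[OF i(1)] by blast
    obtain t where t: "t \<in> V" "p t = i" "t \<noteq> s" using two[OF i(1)] by blast
    have "s \<in> C" "t \<in> C" using in_C s t i by auto
    then show False using s t i px C_eq[OF x(1)] by auto
  qed
  show "f v \<in> C" if "v \<in> V - C" for v using depth[OF that] .
  show "p u = p v" if "u \<in> V - C" "v \<in> V - C" "f u = f v" for u v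
    using sib[OF that depth] that by auto
qed

end


section \<open>Edge bound and equality case under the path property\<close>

text \<open>\<open>path\<close> is what saturation provides: the new edge closes a path of length 3.
  Since edges join different colours, \<open>a \<noteq> w\<close> and \<open>b \<noteq> u\<close>
  turn the walk into a path.\<close>

locale three_path_connected =
  fixes V :: "'a set" and E :: "'a set set" and p :: "'a \<Rightarrow> nat"
  assumes fin: "finite E"
    and edge: "{u, v} \<in> E \<Longrightarrow> u \<in> V \<and> v \<in> V \<and> p u \<noteq> p v"
    and colours: "p ` V \<subseteq> {1..3}"
    and two: "i \<in> {1..3} \<Longrightarrow> \<exists>v\<in>V. p v = i \<and> v \<noteq> c"
    and path: "u \<in> V \<Longrightarrow> w \<in> V \<Longrightarrow> p u \<noteq> p w \<Longrightarrow>
      {u, w} \<in> E \<or> (\<exists>a b. {u, a} \<in> E \<and> {a, b} \<in> E \<and> {b, w} \<in> E \<and> a \<noteq> w \<and> b \<noteq> u)"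
begin

text \<open>With monochromatic neighbourhoods, a path \<open>u, a, b, t\<close> gives
  \<open>a\<close> the colour of \<open>t\<close>, so \<open>u\<close> would have neighbours of both
  other colours.\<close>

lemma exists_two_coloured_neighbourhood:
  "\<exists>u m w. {u, m} \<in> E \<and> {m, w} \<in> E \<and> p u \<noteq> p w"
proof (rule ccontr)
  assume "\<not> ?thesis"
  then have mono: "p u = p w" if "{u, m} \<in> E" "{m, w} \<in> E" for u m w using that by blast
  obtain u where u: "u \<in> V" "p u = 1" using two[of 1] by auto
  obtain v where v: "v \<in> V" "p v = 2" using two[of 2] by auto
  obtain w where w: "w \<in> V" "p w = 3" using two[of 3] by auto
  have *: "\<exists>a. {u, a} \<in> E \<and> p a = p t" if t: "t \<in> V" "p t \<noteq> p u" for t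
    using path[of u t] mono t u by metis
  obtain a b where "{u, a} \<in> E" "p a = 2" "{u, b} \<in> E" "p b = 3"
    using *[of v] *[of w] u v w by auto
  then show False using mono[of a u b] by (simp add: insert_commute)
qed

text \<open>The walk \<open>u, m, w\<close> is closed by an edge or by a path
  \<open>u, a, b, w\<close>; if \<open>m\<close> is \<open>a\<close> or \<open>b\<close>, a triangle
  remains.\<close>

lemma triangle_or_pentagon:
  obtains (triangle) c0 c1 c2 where "{c0, c1} \<in> E" "{c1, c2} \<in> E" "{c2, c0} \<in> E"
  | (pentagon) c0 c1 c2 c3 c4 where "distinct [c0, c1, c2, c3, c4]"
      "{c0, c1} \<in> E" "{c1, c2} \<in> E" "{c2, c3} \<in> E" "{c3, c4} \<in> E" "{c4, c0} \<in> E"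
proof -
  obtain u m w where umw: "{u, m} \<in> E" "{m, w} \<in> E" "p u \<noteq> p w"
    using exists_two_coloured_neighbourhood by blast
  then have "u \<in> V" "w \<in> V" using edge by blast+
  then consider "{u, w} \<in> E"
    | a b where "{u, a} \<in> E" "{a, b} \<in> E" "{b, w} \<in> E" "a \<noteq> w" "b \<noteq> u"
    using path umw by blast
  then show thesis
  proof cases
    case 1
    then show thesis using umw by (intro triangle[of u m w]) (auto simp: insert_commute)
  next
    case 2
    consider (first) "a = m" | (second) "b = m" | (new) "a \<noteq> m" "b \<noteq> m" by blast
    then show thesis
    proof cases
      case first
      then show thesis using 2 umw by (intro triangle[of m b w]) (auto simp: insert_commute)
    next
      case second
      then show thesis using 2 umw by (intro triangle[of u a m]) (auto simp: insert_commute)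
    next
      case new
      have "u \<noteq> m" "m \<noteq> w" "u \<noteq> w" "b \<noteq> w" "a \<noteq> b" "u \<noteq> a" using 2 umw edge by blast+
      then show thesis using 2 new umw
        by (intro pentagon[of u m w b a]) (auto simp: insert_commute)
    qed
  qed
qed

text \<open>\<open>v\<close> differs in colour from \<open>c\<close> or from \<open>c'\<close>, and
  the path property connects it to that vertex.\<close>

lemma adjacent_connected:
  assumes "c \<in> V" "c' \<in> V" "p c \<noteq> p c'" "v \<in> V"
  shows "\<exists>t\<in>{c, c'}. (\<lambda>u v. {u, v} \<in> E)\<^sup>*\<^sup>* v t"
proof -
  obtain t where t: "t \<in> {c, c'}" "p v \<noteq> p t" "t \<in> V" using assms by (metis insertCI)
  have "(\<lambda>u v. {u, v} \<in> E)\<^sup>*\<^sup>* v t"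
    using path[OF \<open>v \<in> V\<close> t(3,2)]
    by (elim disjE exE conjE) (meson converse_rtranclp_into_rtranclp rtranclp.rtrancl_refl)+
  then show ?thesis using t by blast
qed

text \<open>The successor \<open>g\<close> on \<open>C\<close> is extended by parents on shortest
  walks to \<open>C\<close>. If the resulting distinct edges are all of \<open>E\<close>, the path
  property turns into \<open>linked\<close>.\<close>

lemma extend_cycle:
  assumes C: "C \<subseteq> V" and g: "\<And>c. c \<in> C \<Longrightarrow> g c \<in> C \<and> {c, g c} \<in> E \<and> g (g c) \<noteq> c"
    and "C \<noteq> {}"
  obtains d :: "'a \<Rightarrow> nat" and f where "\<And>c. c \<in> C \<Longrightarrow> f c = g c" "card V \<le> card E"
    "card E = card V \<Longrightarrow> E = (\<lambda>v. {v, f v}) ` V \<and> coloured_functional_graph V C f p d"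
proof -
  obtain c where c: "c \<in> C" using \<open>C \<noteq> {}\<close> by blast
  have "\<exists>t\<in>C. (\<lambda>u v. {u, v} \<in> E)\<^sup>*\<^sup>* v t" if "v \<in> V" for v
    using adjacent_connected[of c "g c" v] that c g[OF c] edge[of c "g c"] by blast
  then obtain d :: "'a \<Rightarrow> nat" and h
    where h: "\<And>v. v \<in> V - C \<Longrightarrow> {v, h v} \<in> E \<and> d (h v) < d v"
    using obtain_parent_function[of V C "\<lambda>u v. {u, v} \<in> E"] by blast
  define f where "f v = (if v \<in> C then g v else h v)" for v
  have fE: "{v, f v} \<in> E" if "v \<in> V" for v using g h that by (auto simp: f_def)
  \<comment> \<open>On \<open>C\<close> this is the assumption on \<open>g\<close>; a vertex
    entering \<open>C\<close> never leaves it again; elsewhere \<open>d\<close> decreases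
    twice.\<close>
  have ff: "f (f v) \<noteq> v" if v: "v \<in> V" for v
  proof (cases "v \<in> C \<or> f v \<in> C")
    case True
    then show ?thesis
    proof
      assume "v \<in> C"
      then show ?thesis using g[of v] by (simp add: f_def)
    next
      assume "f v \<in> C"
      then have "f (f v) \<in> C" using g[of "f v"] by (simp add: f_def)
      then show ?thesis using g[of v] by (cases "v \<in> C") (auto simp: f_def)
    qed
  next
    case False
    then have "f v \<in> V - C" using edge[OF fE[OF v]] by blast
    then have "d (f (f v)) < d v" using h[of v] h[of "f v"] v False by (auto simp: f_def)
    then show ?thesis by auto
  qed
  note card = functional_edges[of E V f, OF fin fE ff]
  have E: "coloured_functional_graph V C f p d" if E: "E = (\<lambda>v. {v, f v}) ` V"
  proof
    show "linked f u w" if uw: "u \<in> V" "w \<in> V" "p u \<noteq> p w" for u w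
    proof -
      have adj: "f a = b \<or> f b = a" if "{a, b} \<in> E" for a b
        using that unfolding E by (auto simp: doubleton_eq_iff)
      then show ?thesis using path[OF uw] linked_if_path[of f u _ _ w]
        unfolding linked_def by blast
    qed
    show "f v \<in> V" "p (f v) \<noteq> p v" if "v \<in> V" for v using edge[OF fE[OF that]] by auto
  qed (use colours two C g h in \<open>auto simp: f_def\<close>)
  show thesis
    using card E by (intro that[of f d]) (auto simp: f_def)
qed

lemma triangle_colours:
  assumes "{c0, c1} \<in> E" "{c1, c2} \<in> E" "{c2, c0} \<in> E"
  shows "bij_betw p {c0, c1, c2} {1..3}"
proof -
  have d: "p c0 \<noteq> p c1" "p c1 \<noteq> p c2" "p c2 \<noteq> p c0" and V: "{c0, c1, c2} \<subseteq> V"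
    using assms edge by blast+
  then have inj: "inj_on p {c0, c1, c2}" by (auto simp: inj_on_def)
  moreover have "p ` {c0, c1, c2} = {1..3}"
    using V colours d card_image[OF inj] by (intro card_subset_eq) auto
  ultimately show ?thesis by (simp add: bij_betw_def)
qed

text \<open>Both claims start from the same cycle. A pentagon excludes equality; on a triangle,
  \<open>x i\<close> is the vertex of colour \<open>i\<close>, and \<open>\<sigma> i\<close> is the
  colour of the vertex at which the others of colour \<open>i\<close> hang.\<close>

lemma card_edges_ge: "card V \<le> card E"
  and extremal: "card E = card V \<Longrightarrow>
    \<exists>x \<sigma>. (\<forall>i\<in>{1..3}. x i \<in> V \<and> p (x i) = i) \<and>
      {x 1, x 2} \<in> E \<and> {x 2, x 3} \<in> E \<and> {x 1, x 3} \<in> E \<and>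
      bij_betw \<sigma> {1..3} {1..3} \<and> (\<forall>i\<in>{1..3}. \<sigma> i \<noteq> i) \<and>
      (\<forall>i\<in>{1..3}. \<forall>v\<in>V. p v = i \<longrightarrow> v \<noteq> x i \<longrightarrow> {u. {u, v} \<in> E} = {x (\<sigma> i)})"
    (is "_ \<Longrightarrow> ?ex")
proof -
  have "card V \<le> card E \<and> (card E = card V \<longrightarrow> ?ex)"
  proof (cases rule: triangle_or_pentagon)
    case (triangle c0 c1 c2)
    define C where "C = {c0, c1, c2}"
    have d: "c0 \<noteq> c1" "c1 \<noteq> c2" "c2 \<noteq> c0" and V: "C \<subseteq> V"
      unfolding C_def using triangle edge by blast+
    define g where "g = id(c0 := c1, c1 := c2, c2 := c0)"
    have gC: "g c \<in> C \<and> {c, g c} \<in> E \<and> g (g c) \<noteq> c" if "c \<in> C" for c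
      using that d triangle by (auto simp: C_def g_def)
    obtain d :: "'a \<Rightarrow> nat" and f where fg: "\<And>c. c \<in> C \<Longrightarrow> f c = g c" and card: "card V \<le> card E"
      and E: "card E = card V \<Longrightarrow> E = (\<lambda>v. {v, f v}) ` V \<and> coloured_functional_graph V C f p d"
      by (rule extend_cycle[OF V gC]) (use that in \<open>auto simp: C_def\<close>)
    have ?ex if eq: "card E = card V"
    proof -
      interpret coloured_functional_graph V C f p d using E[OF eq] by blast
      have f: "f c0 = c1" "f c1 = c2" "f c2 = c0" using fg d by (auto simp: C_def g_def)
      note pendant = triangle_pendants(1)[OF C_def f]
      note sibling = triangle_pendants(2)[OF C_def f]
      have bij: "bij_betw p C {1..3}" using triangle_colours triangle by (simp add: C_def)
      define x where "x = inv_into C p"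
      have x: "x i \<in> C" "p (x i) = i" if "i \<in> {1..3}" for i
        using that bij unfolding x_def bij_betw_def by (auto intro: inv_into_into f_inv_into_f)
      have xp: "x (p c) = c" if "c \<in> C" for c
        using that bij unfolding x_def bij_betw_def by simp
      have CE: "{c, c'} \<in> E" if "c \<in> C" "c' \<in> C" "c \<noteq> c'" for c c'
        using that triangle unfolding C_def by (auto simp: insert_commute)
      have xE: "{x i, x j} \<in> E" if "i \<in> {1..3}" "j \<in> {1..3}" "i \<noteq> j" for i j
        using that x CE by metis
      have "\<exists>v. v \<in> V - C \<and> p v = i" if i: "i \<in> {1..3}" for i
      proof -
        obtain v where v: "v \<in> V" "p v = i" "v \<noteq> x i" using two[OF i, of "x i"] by blast
        then have "v \<notin> C" using xp by auto
        then show ?thesis using v by blast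
      qed
      then obtain r where r: "\<And>i. i \<in> {1..3} \<Longrightarrow> r i \<in> V - C \<and> p (r i) = i" by metis
      define \<sigma> where "\<sigma> i = p (f (r i))" for i
      have \<sigma>: "\<sigma> i \<in> {1..3}" "x (\<sigma> i) = f (r i)" if "i \<in> {1..3}" for i
        using pendant r[OF that] xp colours V unfolding \<sigma>_def by blast+
      \<comment> \<open>If \<open>\<sigma> i = \<sigma> j\<close>, then \<open>r i\<close> and
        \<open>r j\<close> hang at the same vertex and so have the same colour.\<close>
      have "inj_on \<sigma> {1..3}"
        using \<sigma> r sibling by (metis inj_onI)
      then have \<sigma>_bij: "bij_betw \<sigma> {1..3} {1..3}"
        unfolding bij_betw_def using \<sigma>(1) by (intro conjI endo_inj_surj) auto
      have neq: "\<sigma> i \<noteq> i" if "i \<in> {1..3}" for i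
        using r[OF that] proper[of "r i"] by (auto simp: \<sigma>_def)
      have nb: "{u. {u, v} \<in> E} = {x (\<sigma> i)}"
        if i: "i \<in> {1..3}" and v: "v \<in> V" "p v = i" "v \<noteq> x i" for i v
      proof -
        have vC: "v \<in> V - C" using v xp by auto
        \<comment> \<open>As \<open>\<sigma>\<close> is onto, \<open>v\<close> hangs where some
          \<open>r j\<close> hangs; equal colours then give \<open>j = i\<close>.\<close>
        have "p (f v) \<in> \<sigma> ` {1..3}"
          using \<sigma>_bij colours f_in v unfolding bij_betw_def by blast
        then obtain j where j: "j \<in> {1..3}" "p (f v) = \<sigma> j" by blast
        then have "f v = f (r j)" using \<sigma> xp[OF pendant[OF vC]] by metis
        then have "p v = p (r j)" using sibling[of v "r j"] vC r j by auto
        then have "f v = x (\<sigma> i)" using j r v \<open>f v = f (r j)\<close> \<sigma>(2) by metis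
        moreover have "{u, v} \<in> E \<longleftrightarrow> u = f v" for u
        proof -
          \<comment> \<open>All values of \<open>f\<close> lie in \<open>C\<close>, so nothing hangs
            at \<open>v\<close>.\<close>
          have "f u \<noteq> v" if "u \<in> V" using pendant f_C vC that by blast
          then show ?thesis using E[OF eq] vC by (auto simp: doubleton_eq_iff insert_commute)
        qed
        ultimately show ?thesis by auto
      qed
      show ?ex
        by (intro exI[of _ x] exI[of _ \<sigma>] conjI ballI impI nb neq \<sigma>_bij xE) (use x V in auto)
    qed
    then show ?thesis using card by blast
  next
    case (pentagon c0 c1 c2 c3 c4)
    define C where "C = {c0, c1, c2, c3, c4}"
    have V: "C \<subseteq> V" unfolding C_def using pentagon edge by blast
    define g where "g = id(c0 := c1, c1 := c2, c2 := c3, c3 := c4, c4 := c0)"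
    have gC: "g c \<in> C \<and> {c, g c} \<in> E \<and> g (g c) \<noteq> c" if "c \<in> C" for c
      using that pentagon by (auto simp: C_def g_def)
    obtain d :: "'a \<Rightarrow> nat" and f where fg: "\<And>c. c \<in> C \<Longrightarrow> f c = g c" and card: "card V \<le> card E"
      and E: "card E = card V \<Longrightarrow> E = (\<lambda>v. {v, f v}) ` V \<and> coloured_functional_graph V C f p d"
      by (rule extend_cycle[OF V gC]) (use that in \<open>auto simp: C_def\<close>)
    have False if eq: "card E = card V"
    proof -
      interpret coloured_functional_graph V C f p d using E[OF eq] by blast
      show False
        by (rule pentagon_impossible[OF C_def pentagon(1)])
          (use fg pentagon(1) in \<open>auto simp: C_def g_def\<close>)
    qed
    then show ?thesis using card by blast
  qed
  then show "card V \<le> card E" "card E = card V \<Longrightarrow> ?ex" by blast+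
qed

end


section \<open>Four-cycles, spanning subgraphs and saturation\<close>

lemma cycle_graph_4: "cycle_graph 4 = ({..<4}, {{0, 1}, {1, 2}, {2, 3}, {3, 0}})"
proof -
  have "{{i, (i + 1) mod 4} | i. i < 4} = (\<lambda>i. {i, (i + 1) mod 4}) ` {..<4::nat}" by auto
  also have "{..<4::nat} = {0, 1, 2, 3}" by auto
  also have "(\<lambda>i. {i, (i + 1) mod 4}) ` {0, 1, 2, 3} = {{0, 1}, {1, 2}, {2, 3}, {3, 0::nat}}"
    by (simp flip: numeral_2_eq_2)
  finally show ?thesis unfolding cycle_graph_def by simp
qed

lemma contains_C4_iff:
  assumes "\<And>e. e \<in> edges G \<Longrightarrow> e \<subseteq> verts G"
  shows "contains_copy G (cycle_graph 4) \<longleftrightarrow>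
    (\<exists>a b c d. distinct [a, b, c, d] \<and>
      {a, b} \<in> edges G \<and> {b, c} \<in> edges G \<and> {c, d} \<in> edges G \<and> {d, a} \<in> edges G)"
    (is "?L \<longleftrightarrow> ?R")
proof
  assume ?L
  then obtain f where f: "inj_on f {..<4::nat}" "{f 0, f 1} \<in> edges G" "{f 1, f 2} \<in> edges G"
    "{f 2, f 3} \<in> edges G" "{f 3, f 0} \<in> edges G"
    unfolding contains_copy_def cycle_graph_4 by auto
  moreover have "distinct [f 0, f 1, f 2, f 3]"
    using inj_on_eq_iff[OF f(1)] by simp
  ultimately show ?R by blast
next
  assume ?R
  then obtain a b c d where *: "distinct [a, b, c, d]" "{a, b} \<in> edges G" "{b, c} \<in> edges G"
    "{c, d} \<in> edges G" "{d, a} \<in> edges G" by blast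
  have four: "{..<4::nat} = {0, 1, 2, 3}" by auto
  have "{a, b, c, d} \<subseteq> verts G" using * assms by blast
  then show ?L
    unfolding contains_copy_def cycle_graph_4 fst_conv snd_conv four using *
    by (intro exI[of _ "\<lambda>i::nat. if i = 0 then a else if i = 1 then b else if i = 2 then c else d"])
      (auto simp: inj_on_def insert_commute)
qed

lemma verts_complete_multipartite: "verts (complete_multipartite k n) = {1..k} \<times> {1..n}"
  by (auto simp: complete_multipartite_def part_def)

lemma edges_complete_multipartite:
  "{u, v} \<in> edges (complete_multipartite k n) \<longleftrightarrow>
    u \<in> {1..k} \<times> {1..n} \<and> v \<in> {1..k} \<times> {1..n} \<and> fst u \<noteq> fst v"
  by (cases u; cases v) (auto simp: complete_multipartite_def part_def doubleton_eq_iff)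

lemma edge_complete_multipartiteE:
  assumes "e \<in> edges (complete_multipartite k n)"
  obtains u v where "e = {u, v}" "u \<in> {1..k} \<times> {1..n}" "v \<in> {1..k} \<times> {1..n}" "fst u \<noteq> fst v"
  using assms by (auto simp: complete_multipartite_def part_def)

lemma spanning_subgraphD:
  assumes "spanning_subgraph H (complete_multipartite k n)"
  shows "verts H = {1..k} \<times> {1..n}" "finite (edges H)"
    "e \<in> edges H \<Longrightarrow> e \<subseteq> verts H"
    "{u, v} \<in> edges H \<Longrightarrow> u \<in> {1..k} \<times> {1..n} \<and> v \<in> {1..k} \<times> {1..n} \<and> fst u \<noteq> fst v"
proof -
  show V: "verts H = {1..k} \<times> {1..n}" and sub: "e \<in> edges H \<Longrightarrow> e \<subseteq> verts H" for e
    using assms by (auto simp: spanning_subgraph_def fin_simple_graph_def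
        verts_complete_multipartite)
  have "edges H \<subseteq> Pow (verts H)" using sub by blast
  then show "finite (edges H)" using V finite_subset by fastforce
  show "{u, v} \<in> edges H \<Longrightarrow> u \<in> {1..k} \<times> {1..n} \<and> v \<in> {1..k} \<times> {1..n} \<and> fst u \<noteq> fst v"
    using assms edges_complete_multipartite[of u v k n] by (auto simp: spanning_subgraph_def)
qed

text \<open>A four-cycle created by adding \<open>{u, w}\<close> passes through this edge; the rest
  of the cycle is a path of length 3 in \<open>H\<close>.\<close>

lemma saturated_three_path_connected:
  assumes n: "n \<ge> 2" and sat: "saturated H (complete_multipartite 3 n) (cycle_graph 4)"
  shows "three_path_connected (verts H) (edges H) fst"
proof
  have H: "spanning_subgraph H (complete_multipartite 3 n)" using sat by (simp add: saturated_def)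
  note D = spanning_subgraphD[OF H]
  show "finite (edges H)" by (rule D(2))
  show "u \<in> verts H \<and> v \<in> verts H \<and> fst u \<noteq> fst v" if "{u, v} \<in> edges H" for u v
    using D(4)[OF that] D(1) by simp
  show "fst ` verts H \<subseteq> {1..3}" using D(1) by auto
  show "\<exists>v\<in>verts H. fst v = i \<and> v \<noteq> c" if "i \<in> {1..3}" for i c
  proof -
    have "(i, 1) \<in> verts H" "(i, 2) \<in> verts H" using that n D(1) by auto
    then show ?thesis by (metis One_nat_def fst_conv snd_conv n_not_Suc_n numeral_2_eq_2)
  qed
  show "{u, w} \<in> edges H \<or> (\<exists>a b. {u, a} \<in> edges H \<and> {a, b} \<in> edges H \<and> {b, w} \<in> edges H \<and> a \<noteq> w \<and> b \<noteq> u)"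
    if uw: "u \<in> verts H" "w \<in> verts H" "fst u \<noteq> fst w" for u w
  proof (cases "{u, w} \<in> edges H")
    case False
    define G where "G = add_edge H {u, w}"
    have G: "edges G = insert {u, w} (edges H)" "verts G = verts H"
      by (simp_all add: G_def add_edge_def)
    have G_sub: "e \<subseteq> verts G" if "e \<in> edges G" for e using that G D(3) uw by auto
    have "{u, w} \<in> edges (complete_multipartite 3 n)"
      using uw D(1) edges_complete_multipartite by simp
    then have copy: "contains_copy G (cycle_graph 4)"
      using sat False by (auto simp: saturated_def G_def)
    \<comment> \<open>Here the new edge is the first one of the cycle \<open>p, q, r, s\<close>; the
      other positions follow by rotation.\<close>
    have key: "\<exists>a b. {u, a} \<in> edges H \<and> {a, b} \<in> edges H \<and> {b, w} \<in> edges H \<and> a \<noteq> w \<and> b \<noteq> u"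
      if e: "{p, q} = {u, w}" and qrs: "{q, r} \<in> edges G" "{r, s} \<in> edges G" "{s, p} \<in> edges G"
        and dist: "distinct [p, q, r, s]" for p q r s
    proof -
      have "{q, r} \<noteq> {u, w}" "{r, s} \<noteq> {u, w}" "{s, p} \<noteq> {u, w}"
        using dist unfolding e[symmetric] by (auto simp: doubleton_eq_iff)
      then have E: "{q, r} \<in> edges H" "{r, s} \<in> edges H" "{s, p} \<in> edges H" using qrs G by auto
      consider "p = u" "q = w" | "p = w" "q = u" using e by (auto simp: doubleton_eq_iff)
      then show ?thesis
      proof cases
        case 1
        then have "{u, s} \<in> edges H \<and> {s, r} \<in> edges H \<and> {r, w} \<in> edges H \<and> s \<noteq> w \<and> r \<noteq> u"
          using E dist by (auto simp: insert_commute)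
        then show ?thesis by blast
      next
        case 2
        then have "{u, r} \<in> edges H \<and> {r, s} \<in> edges H \<and> {s, w} \<in> edges H \<and> r \<noteq> w \<and> s \<noteq> u"
          using E dist by auto
        then show ?thesis by blast
      qed
    qed
    obtain a b c d where abcd: "distinct [a, b, c, d]"
      "{a, b} \<in> edges G" "{b, c} \<in> edges G" "{c, d} \<in> edges G" "{d, a} \<in> edges G"
      using contains_C4_iff[OF G_sub] copy by blast
    have "\<not> contains_copy H (cycle_graph 4)" using sat by (simp add: saturated_def)
    then have "\<not> ({a, b} \<in> edges H \<and> {b, c} \<in> edges H \<and> {c, d} \<in> edges H \<and> {d, a} \<in> edges H)"
      using contains_C4_iff[of H] D(3) abcd(1) by blast
    then consider "{a, b} = {u, w}" | "{b, c} = {u, w}" | "{c, d} = {u, w}" | "{d, a} = {u, w}"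
      using abcd G by auto
    then show ?thesis
      using key[of a b c d] key[of b c d a] key[of c d a b] key[of d a b c] abcd
      by cases auto
  qed simp
qed

section \<open>Saturation of the graphs in the family\<close>

text \<open>A concrete member of the family: \<open>x i = (i, 1)\<close> and \<open>\<sigma>\<close>
  is the cyclic shift. The vertices \<open>(i, 1)\<close> themselves contribute the
  triangle.\<close>

definition omega_graph :: "nat \<Rightarrow> (nat \<times> nat) graph" where
  "omega_graph n = ({1..3} \<times> {1..n}, (\<lambda>v. {v, (fst v mod 3 + 1, 1)}) ` ({1..3} \<times> {1..n}))"


lemma omega_graph_in_Omega:
  assumes "n \<ge> 1"
  shows "omega_graph n \<in> Omega_4_3 n"
proof -
  define r where "r i = i mod 3 + 1" for i :: nat
  have three: "{1..3::nat} = {1, 2, 3}" by auto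
  have r: "r i \<in> {1..3}" "r i \<noteq> i" for i
    unfolding r_def atLeastAtMost_iff by presburger+
  have rv: "r 1 = 2" "r 2 = 3" "r 3 = 1" by (simp_all add: r_def)
  have E: "edges (omega_graph n) = (\<lambda>v. {v, (r (fst v), 1)}) ` ({1..3} \<times> {1..n})"
    "verts (omega_graph n) = {1..3} \<times> {1..n}"
    by (simp_all add: omega_graph_def r_def)
  have edge: "{v, (r (fst v), 1)} \<in> edges (complete_multipartite 3 n)" if "v \<in> {1..3} \<times> {1..n}" for v
    unfolding edges_complete_multipartite using that assms r(1)[of "fst v"] r(2)[of "fst v"] by auto
  have "spanning_subgraph (omega_graph n) (complete_multipartite 3 n)"
  proof -
    have "e \<subseteq> {1..3} \<times> {1..n} \<and> card e = 2" if e: "e \<in> edges (omega_graph n)" for e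
    proof -
      obtain v where v: "v \<in> {1..3} \<times> {1..n}" "e = {v, (r (fst v), 1)}"
        using e unfolding E by blast
      with edge[OF v(1)] show ?thesis
        unfolding edges_complete_multipartite by (auto simp: card_insert_if)
    qed
    then show ?thesis
      unfolding spanning_subgraph_def fin_simple_graph_def verts_complete_multipartite
      using E edge by auto
  qed
  moreover have tri: "{(i, 1), (r i, 1)} \<in> edges (omega_graph n)" if "i \<in> {1..3}" for i
    unfolding E using that assms by (intro image_eqI[of _ _ "(i, 1)"]) auto
  moreover have "bij_betw r {1..3} {1..3}"
    unfolding bij_betw_def inj_on_def three using rv by auto
  moreover have "neighbours (omega_graph n) v = {(r i, 1)}"
    if i: "i \<in> {1..3}" and v: "v \<in> part n i - {(i, 1)}" for i v
  proof -
    have "u = (r i, 1)" if uv: "{u, v} \<in> edges (omega_graph n)" for u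
    proof -
      obtain t where t: "{u, v} = {t, (r (fst t), 1)}" using uv unfolding E by blast
      \<comment> \<open>The triangle vertices have second coordinate 1, so \<open>v\<close> can only
        be the end \<open>t\<close> of the edge.\<close>
      have "snd v \<noteq> 1" "fst v = i" using v by (auto simp: part_def)
      then have "v = t" "u = (r (fst t), 1)" using t unfolding doubleton_eq_iff by (metis snd_conv)+
      then show ?thesis using \<open>fst v = i\<close> by simp
    qed
    moreover have "{(r i, 1), v} \<in> edges (omega_graph n)"
      unfolding E using i v by (intro image_eqI[of _ _ v]) (auto simp: part_def)
    ultimately show ?thesis unfolding neighbours_def by blast
  qed
  ultimately show ?thesis
    unfolding Omega_4_3_def degree_def
    using tri[of 1, unfolded rv] tri[of 2, unfolded rv] tri[of 3, unfolded rv] r assms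
    by (intro CollectI conjI exI[of _ "\<lambda>i. (i, 1)"] exI[of _ r])
      (auto simp: part_def insert_commute)
qed

text \<open>Each vertex again owns one edge, and a four-cycle would need four vertices of degree at
  least 2. A missing edge has an end outside the triangle, and its ends are joined by a path of
  length 3 through the triangle.\<close>

lemma Omega_saturated:
  assumes H: "H \<in> Omega_4_3 n" and n: "n \<ge> 2"
  shows "saturated H (complete_multipartite 3 n) (cycle_graph 4)" "card (edges H) = 3 * n"
proof -
  have span: "spanning_subgraph H (complete_multipartite 3 n)"
    using H by (simp add: Omega_4_3_def)
  note D = spanning_subgraphD[OF span]
  obtain x \<sigma> where x: "\<forall>i\<in>{1..3}. x i \<in> part n i"
    and tri: "{x 1, x 2} \<in> edges H" "{x 2, x 3} \<in> edges H" "{x 1, x 3} \<in> edges H"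
    and \<sigma>: "bij_betw \<sigma> {1..3} {1..3}" "\<forall>i\<in>{1..3}. \<sigma> i \<noteq> i"
    and pend: "\<forall>i\<in>{1..3}. \<forall>v\<in>part n i - {x i}. neighbours H v = {x (\<sigma> i)}"
    using H unfolding Omega_4_3_def by blast
  define X where "X = x ` {1..3}"
  have three: "{1..3::nat} = {1, 2, 3}" by auto
  have fx: "fst (x i) = i" if "i \<in> {1..3}" for i using x that unfolding part_def by force
  have x_inj: "x i \<noteq> x j" if "i \<in> {1..3}" "j \<in> {1..3}" "i \<noteq> j" for i j
    using that fx by metis
  have \<sigma>_in: "\<sigma> i \<in> {1..3}" if "i \<in> {1..3}" for i using \<sigma>(1) that by (auto simp: bij_betw_def)
  have XE: "{x i, x j} \<in> edges H" if "i \<in> {1..3}" "j \<in> {1..3}" "i \<noteq> j" for i j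
    using that tri unfolding three by (auto simp: insert_commute)
  have V: "verts H = {1..3} \<times> {1..n}" by (rule D(1))
  have XV: "x i \<in> verts H" if "i \<in> {1..3}" for i
  proof -
    have "part n i \<subseteq> verts H" using that V by (auto simp: part_def)
    then show ?thesis using x that by blast
  qed
  have pendant: "{u, v} \<in> edges H \<longleftrightarrow> u = x (\<sigma> (fst v))" if "v \<in> verts H" "v \<notin> X" for u v
  proof -
    have "fst v \<in> {1..3}" "v \<in> part n (fst v) - {x (fst v)}"
      using that V by (auto simp: part_def X_def)
    then have "neighbours H v = {x (\<sigma> (fst v))}" using pend by blast
    then show ?thesis by (auto simp: neighbours_def)
  qed

  \<comment> \<open>\<open>f\<close> runs round the triangle and sends every other vertex to its
    only neighbour.\<close>
  define f where "f v = (if v = x 1 then x 2 else if v = x 2 then x 3 else if v = x 3 then x 1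
    else x (\<sigma> (fst v)))" for v
  have f_out: "f v = x (\<sigma> (fst v))" if "v \<notin> X" for v
    using that unfolding f_def X_def three by auto
  have dist: "x 1 \<noteq> x 2" "x 2 \<noteq> x 3" "x 1 \<noteq> x 3" using fx[of 1] fx[of 2] fx[of 3] by auto
  have fX: "f v \<in> X" if "v \<in> verts H" for v
    using that \<sigma>_in V unfolding f_def X_def by auto
  have fE: "{v, f v} \<in> edges H" if "v \<in> verts H" for v
    using pendant[of v "f v"] that tri unfolding f_def X_def three
    by (auto simp: insert_commute)
  have ff: "f (f v) \<noteq> v" if "v \<in> verts H" for v
  proof (cases "v \<in> X")
    case True
    then show ?thesis using dist unfolding X_def three f_def by auto
  next
    case False
    then show ?thesis using fX[OF that] fX[of "f v"] XV unfolding X_def by force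
  qed
  have "edges H \<subseteq> (\<lambda>v. {v, f v}) ` verts H"
  proof
    fix e assume e: "e \<in> edges H"
    then have "e \<in> edges (complete_multipartite 3 n)"
      using span by (auto simp: spanning_subgraph_def)
    then obtain u v where uv: "e = {u, v}" "u \<in> verts H" "v \<in> verts H" "u \<noteq> v"
      unfolding V by (rule edge_complete_multipartiteE) blast
    have "u = f v \<or> v = f u"
    proof (cases "u \<in> X \<and> v \<in> X")
      case True
      then show ?thesis using uv(4) dist unfolding X_def three f_def by auto
    next
      case False
      then show ?thesis
        using e pendant[of u v] pendant[of v u] uv f_out by (metis insert_commute)
    qed
    then show "e \<in> (\<lambda>v. {v, f v}) ` verts H" using uv by auto
  qed
  then have "card (edges H) \<le> card (verts H)"
    using V by (intro surj_card_le) auto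
  moreover have "card (verts H) \<le> card (edges H)"
    by (rule functional_edges(1)[OF D(2) fE ff])
  ultimately show "card (edges H) = 3 * n" using V by simp

  have "\<not> contains_copy H (cycle_graph 4)"
  proof
    assume "contains_copy H (cycle_graph 4)"
    then obtain a b c d where abcd: "distinct [a, b, c, d]"
      "{a, b} \<in> edges H" "{b, c} \<in> edges H" "{c, d} \<in> edges H" "{d, a} \<in> edges H"
      using contains_C4_iff[of H] D(3) by blast
    \<comment> \<open>A vertex with two neighbours lies on the triangle.\<close>
    have two: "v \<in> X" if "{u, v} \<in> edges H" "{v, w} \<in> edges H" "u \<noteq> w" for u v w
      using that pendant[of v u] pendant[of v w] D(3)[OF that(1)]
      by (auto simp: insert_commute)
    have "set [a, b, c, d] \<subseteq> X"
      using two[of d a b] two[of a b c] two[of b c d] two[of c d a] abcd by auto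
    then have "card (set [a, b, c, d]) \<le> card X" by (intro card_mono) (auto simp: X_def)
    also have "\<dots> \<le> 3" unfolding X_def using card_image_le[of "{1..3}" x] by simp
    finally show False using distinct_card[OF abcd(1)] by simp
  qed
  moreover have "contains_copy (add_edge H e) (cycle_graph 4)"
    if e: "e \<in> edges (complete_multipartite 3 n) - edges H" for e
  proof -
    obtain u w where uw: "e = {u, w}" "u \<in> verts H" "w \<in> verts H" "fst u \<noteq> fst w"
      using e V by (metis DiffD1 edge_complete_multipartiteE)
    have path: "\<exists>a b. {u, a} \<in> edges H \<and> {a, b} \<in> edges H \<and> {b, w} \<in> edges H \<and> distinct [u, a, b, w]"
      if uw: "u \<in> verts H" "w \<in> verts H" "fst u \<noteq> fst w" "{u, w} \<notin> edges H" "u \<notin> X" for u w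
    proof -
      have i: "fst u \<in> {1..3}" "fst w \<in> {1..3}" using uw V by auto
      note s = \<sigma>_in[OF i(1)]  \<sigma>_in[OF i(2)]
      have ua: "{u, x (\<sigma> (fst u))} \<in> edges H"
        using pendant[of u "x (\<sigma> (fst u))"] uw by (simp add: insert_commute)
      show ?thesis
      proof (cases "w \<in> X")
        case True
        then obtain j where j: "j \<in> {1..3}" "w = x j" by (auto simp: X_def)
        \<comment> \<open>The second inequality holds because \<open>u\<close> and \<open>w\<close>
          are not adjacent. So the path can visit all three triangle vertices, ending at
          \<open>w\<close>.\<close>
        then have ij: "fst u \<noteq> j" "\<sigma> (fst u) \<noteq> j" using ua uw fx by auto
        have "\<sigma> (fst u) \<noteq> fst u" using \<sigma>(2) i by blast
        then have "{x (\<sigma> (fst u)), x (fst u)} \<in> edges H" "{x (fst u), w} \<in> edges H"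
          "distinct [x (\<sigma> (fst u)), x (fst u), w]"
          using XE x_inj i s j ij by auto
        moreover have "u \<noteq> x (\<sigma> (fst u))" "u \<noteq> x (fst u)" "u \<noteq> w"
          using uw i s by (auto simp: X_def)
        ultimately show ?thesis
          using ua by (intro exI[of _ "x (\<sigma> (fst u))"] exI[of _ "x (fst u)"]) auto
      next
        case False
        have "{w, x (\<sigma> (fst w))} \<in> edges H"
          using pendant[of w "x (\<sigma> (fst w))"] uw False by (simp add: insert_commute)
        \<comment> \<open>Injectivity of \<open>\<sigma>\<close> makes the neighbours of
          \<open>u\<close> and \<open>w\<close> two different, hence adjacent, triangle
          vertices.\<close>
        moreover have "\<sigma> (fst u) \<noteq> \<sigma> (fst w)"
          using \<sigma>(1) i uw by (auto simp: bij_betw_def inj_on_def)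
        then have "{x (\<sigma> (fst u)), x (\<sigma> (fst w))} \<in> edges H" "x (\<sigma> (fst u)) \<noteq> x (\<sigma> (fst w))"
          using XE x_inj s by auto
        moreover have "x (\<sigma> (fst u)) \<in> X" "x (\<sigma> (fst w)) \<in> X" using s by (auto simp: X_def)
        ultimately show ?thesis
          using ua uw False
          by (intro exI[of _ "x (\<sigma> (fst u))"] exI[of _ "x (\<sigma> (fst w))"])
            (auto simp: insert_commute)
      qed
    qed
    have "\<exists>a b. {u, a} \<in> edges H \<and> {a, b} \<in> edges H \<and> {b, w} \<in> edges H \<and> distinct [u, a, b, w]"
    proof (cases "u \<in> X")
      case False
      then show ?thesis using path uw e by blast
    next
      case True
      \<comment> \<open>Two triangle vertices would be adjacent, so \<open>w\<close> is outside and
        the path is read backwards.\<close>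
      have "w \<notin> X" using True uw XE fx e by (auto simp: X_def)
      then obtain a b where "{w, a} \<in> edges H" "{a, b} \<in> edges H" "{b, u} \<in> edges H" "distinct [w, a, b, u]"
        using path[of w u] uw e by (auto simp: insert_commute)
      then show ?thesis
        by (intro exI[of _ b] exI[of _ a]) (auto simp: insert_commute)
    qed
    then obtain a b where "{u, a} \<in> edges H" "{a, b} \<in> edges H" "{b, w} \<in> edges H" "distinct [u, a, b, w]"
      by blast
    then have "distinct [u, a, b, w] \<and> {u, a} \<in> edges (add_edge H e) \<and> {a, b} \<in> edges (add_edge H e) \<and>
        {b, w} \<in> edges (add_edge H e) \<and> {w, u} \<in> edges (add_edge H e)"
      using uw(1) by (auto simp: add_edge_def insert_commute)
    moreover have "e' \<subseteq> verts (add_edge H e)" if "e' \<in> edges (add_edge H e)" for e'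
      using that D(3) uw by (auto simp: add_edge_def)
    ultimately show ?thesis
      using contains_C4_iff[of "add_edge H e"] by blast
  qed
  ultimately show "saturated H (complete_multipartite 3 n) (cycle_graph 4)"
    using span by (auto simp: saturated_def)
qed

section \<open>Extremal graphs and the saturation number\<close>

lemma saturated_extremal_in_Omega:
  assumes n: "n \<ge> 2" and sat: "saturated H (complete_multipartite 3 n) (cycle_graph 4)"
    and card: "card (edges H) = 3 * n"
  shows "H \<in> Omega_4_3 n"
proof -
  interpret three_path_connected "verts H" "edges H" fst
    by (rule saturated_three_path_connected[OF n sat])
  have H: "spanning_subgraph H (complete_multipartite 3 n)" using sat by (simp add: saturated_def)
  note V = spanning_subgraphD(1)[OF H]
  have part: "part n i = {v \<in> verts H. fst v = i}" if "i \<in> {1..3}" for i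
    using that V by (auto simp: part_def)
  obtain x \<sigma> where "\<forall>i\<in>{1..3}. x i \<in> verts H \<and> fst (x i) = i"
      "{x 1, x 2} \<in> edges H" "{x 2, x 3} \<in> edges H" "{x 1, x 3} \<in> edges H"
      "bij_betw \<sigma> {1..3} {1..3}" "\<forall>i\<in>{1..3}. \<sigma> i \<noteq> i"
      "\<forall>i\<in>{1..3}. \<forall>v\<in>verts H. fst v = i \<longrightarrow> v \<noteq> x i \<longrightarrow> {u. {u, v} \<in> edges H} = {x (\<sigma> i)}"
    using extremal card V by auto
  then show ?thesis
    unfolding Omega_4_3_def degree_def neighbours_def
    by (intro CollectI conjI H exI[of _ x] exI[of _ \<sigma>]) (auto simp: part)
qed

theorem theorem1p5:
  fixes n :: nat
  assumes "n \<ge> 2"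
  shows "sat (complete_multipartite 3 n) (cycle_graph 4) = 3 * n \<and>
         (\<forall>H. spanning_subgraph H (complete_multipartite 3 n) \<longrightarrow>
           (saturated H (complete_multipartite 3 n) (cycle_graph 4) \<and> card (edges H) = 3 * n
              \<longleftrightarrow> H \<in> Omega_4_3 n))"
proof -
  have lower: "3 * n \<le> card (edges H)"
    if sat: "saturated H (complete_multipartite 3 n) (cycle_graph 4)" for H
  proof -
    have "verts H = {1..3} \<times> {1..n}"
      using sat spanning_subgraphD(1) by (auto simp: saturated_def)
    then show ?thesis
      using three_path_connected.card_edges_ge[OF saturated_three_path_connected[OF assms sat]]
      by simp
  qed
  \<comment> \<open>This member of the family attains the lower bound.\<close>
  have "omega_graph n \<in> Omega_4_3 n" using omega_graph_in_Omega assms by simp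
  then have "sat (complete_multipartite 3 n) (cycle_graph 4) = 3 * n"
    unfolding sat_def using Omega_saturated assms lower by (intro Least_equality) blast+
  then show ?thesis
    using Omega_saturated saturated_extremal_in_Omega assms by blast
qed

end
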